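(* Assume: (A1) $\mathcal{X}$ is compact. (A2) For $\mathbb{P}_Z$-a.e. $z\in\mathcal{Z}$ and every $x\in\mathcal{X}$: $\mathbb{E}_{\mathbb{P}(z)}|f(x,\xi)|<\infty$, and the conditional $\tau$-quantile $Q_\tau(x;z)$ is finite and unique (i.e. $u\mapsto \mathbb{E}_{\mathbb{P}(z)}[\rho_\tau(f(x,\xi)-u)]$ has a unique minimizer over $\mathbb{R}$). (A3) For $\mathbb{P}_Z$-a.e. $z\in\mathcal{Z}$: there exist $\alpha>0$ and $L_1>0$ such that $|Q_\tau(x_1;z)-Q_\tau(x_2;z)|\le L_1\|x_1-x_2\|^\alpha$ for all $x_1,x_2\in\mathcal{X}$; and there exist $\beta>0$ and $L_2>0$, independent of the data $\mathcal{D}_N$ (the same for every $N$ and every data realization), such that $|\widehat{Q}^N_\tau(x_1;z)-\widehat{Q}^N_\tau(x_2;z)|\le L_2\|x_1-x_2\|^\beta$ for all $x_1,x_2\in\mathcal{X}$. (A4) For $\mathbb{P}_Z$-a.e. $z\in\mathcal{Z}$: (a) there exists a compact set $B_z\subseteq\Xi$ with $\mathbb{P}(\xi\in B_z\mid Z=z)>0$; (b) for any $x\in\mathcal{X}$ and $u\in\mathbb{R}$, $\mathbb{E}_{\widehat{\mathbb{P}}_N(z)}[\rho_\tau(f(x,\xi)-u)]\to\mathbb{E}_{\mathbb{P}(z)}[\rho_\tau(f(x,\xi)-u)]$ almost surely as $N\to\infty$; (c) for any measurable set $A\subseteq\Xi$, $\mathbb{E}_{\widehat{\mathbb{P}}_N(z)}(\mathbf{1}_A)\to\mathbb{E}_{\mathbb{P}(z)}(\mathbf{1}_A)$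 almost surely as $N\to\infty$. Then, for $\mathbb{P}_Z$-a.e. $z\in\mathcal{Z}$, almost surely as $N\to\infty$: (i) $\widehat{v}^N(z)\to v^\star(z)$; (ii) $\sup_{x\in\widehat{\mathcal{X}}^N(z)}Q_\tau(x;z)\to v^\star(z)$; (iii) $D(\widehat{\mathcal{X}}^N(z),\mathcal{X}^\star(z))\to 0$.
   Context: Let $\mathcal{X}\subseteq\mathbb{R}^n$ be the (nonempty) first-stage feasible set and $\tau\in(0,1)$. $\xi$ is a random vector with support $\Xi\subseteq\mathbb{R}^\ell$, and $Z$ is a random vector with support $\mathcal{Z}\subseteq\mathbb{R}^p$ and distribution $\mathbb{P}_Z$; $\mathbb{P}(z)$ denotes the conditional distribution of $\xi$ given $Z=z$. For fixed matrices $T,W,C$ and vectors $h$, $q\in\mathbb{R}^m$ of compatible dimensions, $$f(x,\xi)=\min_{y\in\mathbb{R}^m}\{q^\top y \mid Tx+Wy+C\xi\ge h,\ y\ge 0\},$$ and it is a standing assumption that for all $x\in\mathcal{X}$, $\xi\in\Xi$ this linear program has an optimal solution and $f(x,\xi)>0$. The check loss is $\rho_\tau(u)=u(\tau-\mathbf{1}(u<0))$. The conditional quantile is $Q_\tau(x;z)=\inf\{t\in\mathbb{R}\mid \mathbb{P}(f(x,\xi)\le t\mid Z=z)\ge\tau\}$; equivalently it is the (smallest) minimizer over $u\in\mathbb{R}$ of $\mathbb{E}_{\mathbb{P}(z)}[\rho_\tau(f(x,\xi)-u)]$. $(Z^1,\xi^1),(Z^2,\xi^2),\dots$ is a sequence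 of samples of $(Z,\xi)$ and $\mathcal{D}_N=\{(Z^i,\xi^i)\}_{i=1}^N$. For each $N$ and $z$, $\widehat{\mathbb{P}}_N(z)$ is a data-dependent (determined by $\mathcal{D}_N$) probability distribution on $\Xi$ serving as an estimate of $\mathbb{P}(z)$, for which the expectations used are well-defined and finite. The estimated conditional quantile $\widehat{Q}^N_\tau(x;z)$ is the minimizer over $u\in\mathbb{R}$ of $\mathbb{E}_{\widehat{\mathbb{P}}_N(z)}[\rho_\tau(f(x,\xi)-u)]$, the smallest one if not unique. "Almost surely" is with respect to the randomness of the data. The true problem is $v^\star(z)=\min_{x\in\mathcal{X}}Q_\tau(x;z)$ with set of optimal solutions $\mathcal{X}^\star(z)$; the sample problem is $\widehat{v}^N(z)=\min_{x\in\mathcal{X}}\widehat{Q}^N_\tau(x;z)$ with set of optimal solutions $\widehat{\mathcal{X}}^N(z)$. For sets $\mathcal{S}_1,\mathcal{S}_2$, $D(\mathcal{S}_1,\mathcal{S}_2)=\sup_{s_1\in\mathcal{S}_1}\inf_{s_2\in\mathcal{S}_2}\|s_1-s_2\|$, with $\|\cdot\|$ the Euclidean norm. *)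

theory Defs
  imports "HOL-Probability.Probability"
begin

text \<open>Topological support of a Borel measure.\<close>

definition msupport :: "'a::topological_space measure \<Rightarrow> 'a set" where
  "msupport \<mu> = {x. \<forall>U. open U \<longrightarrow> x \<in> U \<longrightarrow> 0 < emeasure \<mu> U}"

text \<open>\<^term>\<open>\<kappa>\<close> is a regular conditional distribution of \<^term>\<open>X\<close> given \<^term>\<open>Z\<close> on the
  probability space \<^term>\<open>M\<close>: a Markov kernel that disintegrates the joint law.\<close>

definition is_cond_distr ::
  "'w measure \<Rightarrow> ('w \<Rightarrow> 'a::topological_space) \<Rightarrow> ('w \<Rightarrow> 'b::topological_space)
    \<Rightarrow> ('b \<Rightarrow> 'a measure) \<Rightarrow> bool" where
  "is_cond_distr M X Z \<kappa> \<longleftrightarrow>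
     \<kappa> \<in> borel \<rightarrow>\<^sub>M prob_algebra borel \<and>
     (\<forall>A\<in>sets borel. \<forall>B\<in>sets borel.
        emeasure M {\<omega> \<in> space M. Z \<omega> \<in> A \<and> X \<omega> \<in> B}
          = (\<integral>\<^sup>+z\<in>A. emeasure (\<kappa> z) B \<partial>distr M borel Z))"

text \<open>Second-stage linear program. The order on vectors is componentwise. The infimum is a
  minimum whenever the program has an optimal solution.\<close>

definition lp_feasible ::
  "real^'n^'r \<Rightarrow> real^'m^'r \<Rightarrow> real^'l^'r \<Rightarrow> real^'r \<Rightarrow> real^'n \<Rightarrow> real^'l \<Rightarrow> real^'m \<Rightarrow> bool" where
  "lp_feasible T W C h x \<xi> y \<longleftrightarrow> T *v x + W *v y + C *v \<xi> \<ge> h \<and> y \<ge> 0"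

definition recourse ::
  "real^'n^'r \<Rightarrow> real^'m^'r \<Rightarrow> real^'l^'r \<Rightarrow> real^'r \<Rightarrow> real^'m \<Rightarrow> real^'n \<Rightarrow> real^'l \<Rightarrow> real" where
  "recourse T W C h q x \<xi> = Inf {q \<bullet> y |y. lp_feasible T W C h x \<xi> y}"

definition check_loss :: "real \<Rightarrow> real \<Rightarrow> real" where
  "check_loss \<tau> u = u * (\<tau> - (if u < 0 then 1 else 0))"

definition check_risk :: "real \<Rightarrow> 'a measure \<Rightarrow> ('a \<Rightarrow> real) \<Rightarrow> real \<Rightarrow> real" where
  "check_risk \<tau> \<mu> g u = (\<integral>\<xi>. check_loss \<tau> (g \<xi> - u) \<partial>\<mu>)"

definition is_minimizer :: "('a \<Rightarrow> real) \<Rightarrow> 'a set \<Rightarrow> 'a \<Rightarrow> bool" where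
  "is_minimizer g S x \<longleftrightarrow> is_arg_min g (\<lambda>y. y \<in> S) x"

definition quantile :: "real \<Rightarrow> 'a measure \<Rightarrow> ('a \<Rightarrow> real) \<Rightarrow> real" where
  "quantile \<tau> \<mu> g = Inf {t. measure \<mu> {\<xi> \<in> space \<mu>. g \<xi> \<le> t} \<ge> \<tau>}"

definition est_quantile :: "real \<Rightarrow> 'a measure \<Rightarrow> ('a \<Rightarrow> real) \<Rightarrow> real" where
  "est_quantile \<tau> \<mu> g = (LEAST u. is_minimizer (check_risk \<tau> \<mu> g) UNIV u)"

text \<open>The following infima and suprema are taken in the reals, so they carry their usual
  meaning only for nonempty, suitably bounded sets. Continuity of the quantile functions on the
  nonempty compact feasible set guarantees this wherever they are used.\<close>

definition opt_value :: "('a \<Rightarrow> real) \<Rightarrow> 'a set \<Rightarrow> real" where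
  "opt_value g S = (INF x\<in>S. g x)"

definition opt_set :: "('a \<Rightarrow> real) \<Rightarrow> 'a set \<Rightarrow> 'a set" where
  "opt_set g S = {x. is_minimizer g S x}"

definition set_deviation :: "'a::real_normed_vector set \<Rightarrow> 'a set \<Rightarrow> real" where
  "set_deviation S1 S2 = (SUP s1\<in>S1. INF s2\<in>S2. norm (s1 - s2))"

end

theory Submission
  imports Defs
begin

text \<open>Fix \<open>z\<close>. The check risk is convex in \<open>u\<close>, and the true one has the quantile as its unique
  minimizer; therefore pointwise convergence of the estimated risks on the rationals already forces
  their minimizers, the estimated quantiles, to converge. Doing this simultaneously on a countable
  dense subset of \<open>X\<close> costs only countably many null sets, and the common Hoelder modulus together
  with compactness upgrades the convergence to uniform convergence on \<open>X\<close>. Convergence of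
  optimal values and of optimal solutions is then deterministic.\<close>

section \<open>Minimizers\<close>

lemma is_minimizer_iff:
  fixes g :: "'a \<Rightarrow> real"
  shows "is_minimizer g S x \<longleftrightarrow> x \<in> S \<and> (\<forall>y\<in>S. g x \<le> g y)"
  by (auto simp: is_minimizer_def is_arg_min_linorder)

lemma is_minimizerI: "x \<in> S \<Longrightarrow> (\<And>y. y \<in> S \<Longrightarrow> g x \<le> g y) \<Longrightarrow> is_minimizer g S x"
  by (simp add: is_minimizer_iff)

lemma is_minimizerD:
  assumes "is_minimizer g S x"
  shows "x \<in> S" "\<And>y. y \<in> S \<Longrightarrow> g x \<le> g y"
  using assms by (auto simp: is_minimizer_iff)

lemma opt_value_eq: "is_minimizer g S x \<Longrightarrow> opt_value g S = g x"
  unfolding opt_value_def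
  by (rule cInf_eq_minimum) (auto dest: is_minimizerD)

lemma is_minimizer_opt_value: "x \<in> S \<Longrightarrow> g x = opt_value g S \<Longrightarrow> is_minimizer g S y \<Longrightarrow> is_minimizer g S x"
  by (metis is_minimizerI is_minimizerD(2) opt_value_eq)

lemma continuous_minimizer_exists:
  assumes "compact S" "S \<noteq> {}" "continuous_on S g"
  obtains x where "is_minimizer g S x"
  using continuous_attains_inf[OF assms] by (auto intro: is_minimizerI)

text \<open>A rational \<open>c\<close> near \<open>m0\<close> eventually has smaller value than two rationals on either side of
  it, and convexity then keeps every minimizer between these two.\<close>

lemma convex_minimizers_tendsto:
  fixes G :: "'a \<Rightarrow> real \<Rightarrow> real"
  assumes ev: "\<forall>\<^sub>F N in F. convex_on UNIV (G N) \<and> is_minimizer (G N) UNIV (m N)"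
    and conv: "\<And>u. u \<in> \<rat> \<Longrightarrow> ((\<lambda>N. G N u) \<longlongrightarrow> g u) F"
    and cont: "isCont g m0"
    and uniq: "\<And>u. u \<noteq> m0 \<Longrightarrow> g m0 < g u"
  shows "(m \<longlongrightarrow> m0) F"
proof (rule tendstoI)
  fix e :: real assume e: "0 < e"
  \<comment> \<open>Convergence is known at rational points only, so the two barriers inside the
    \<open>e\<close>-ball are rational.\<close>
  obtain a where a: "a \<in> \<rat>" "m0 - e < a" "a < m0"
    using Rats_dense_in_real[of "m0 - e" m0] e by auto
  obtain b where b: "b \<in> \<rat>" "m0 < b" "b < m0 + e"
    using Rats_dense_in_real[of m0 "m0 + e"] e by auto
  have "\<forall>\<^sub>F c in nhds m0. g c < min (g a) (g b)"
    using cont uniq[of a] uniq[of b] a b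
    by (intro order_tendstoD(2)[of g "g m0"]) (auto simp: continuous_at tendsto_at_iff_tendsto_nhds)
  then obtain d where d: "d > 0" "\<And>c. dist c m0 < d \<Longrightarrow> g c < min (g a) (g b)"
    by (auto simp: eventually_nhds_metric)
  \<comment> \<open>\<open>m0\<close> itself may be irrational. By continuity of \<open>g\<close> a
    rational \<open>c\<close> strictly between \<open>a\<close> and \<open>b\<close> takes over its
    role.\<close>
  obtain c where c: "c \<in> \<rat>" "m0 < c" "c < min b (m0 + d)"
    using Rats_dense_in_real[of m0 "min b (m0 + d)"] b d(1) by auto
  have gc: "g c < g a" "g c < g b"
    using d(2)[of c] c by (auto simp: dist_real_def)
  have less: "\<forall>\<^sub>F N in F. G N c < G N s" if "s \<in> \<rat>" "g c < g s" for s
  proof -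
    have "((\<lambda>N. G N s - G N c) \<longlongrightarrow> g s - g c) F"
      using that c by (intro tendsto_diff conv)
    then have "\<forall>\<^sub>F N in F. 0 < G N s - G N c"
      by (rule order_tendstoD(1)) (use that in simp)
    then show ?thesis by simp
  qed
  show "\<forall>\<^sub>F N in F. dist (m N) m0 < e"
    using less[OF a(1) gc(1)] less[OF b(1) gc(2)] ev
  proof eventually_elim
    case (elim N)
    \<comment> \<open>On the segment from a minimizer to \<open>c\<close>, convexity caps
      \<open>G N\<close> by the larger endpoint value, which is \<open>G N c\<close>. If
      \<open>m N\<close> lay beyond \<open>a\<close> or \<open>b\<close>, that barrier would be on
      the segment, yet its value exceeds \<open>G N c\<close>.\<close>
    have le: "G N s \<le> G N c" if s: "s \<in> closed_segment (m N) c" for s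
    proof -
      obtain t where t: "0 \<le> t" "t \<le> 1" "s = (1 - t) * m N + t * c"
        using s by (auto simp: closed_segment_def)
      have "G N s \<le> (1 - t) * G N (m N) + t * G N c"
        using convex_onD[of UNIV "G N" t "m N" c] elim(3) t by simp
      also have "\<dots> \<le> (1 - t) * G N c + t * G N c"
        using is_minimizerD(2)[of "G N" UNIV "m N" c] elim(3) t by (simp add: mult_left_mono)
      finally show ?thesis by (simp add: algebra_simps)
    qed
    have "\<not> m N < a"
    proof
      assume "m N < a"
      then have "a \<in> closed_segment (m N) c" using a c by (simp add: closed_segment_eq_real_ivl)
      from le[OF this] elim(1) show False by simp
    qed
    moreover have "\<not> b < m N"
    proof
      assume "b < m N"
      then have "b \<in> closed_segment (m N) c" using b c by (simp add: closed_segment_eq_real_ivl)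
      from le[OF this] elim(2) show False by simp
    qed
    ultimately show ?case using a b by (auto simp: dist_real_def)
  qed
qed

section \<open>Check risk and quantiles\<close>

text \<open>The two branches differ by \<open>u\<close>, so the sign test picks the larger one. As a
  maximum of linear functions the loss inherits convexity, Lipschitz continuity and
  integrability.\<close>

lemma check_loss_eq_max: "check_loss \<tau> u = max (\<tau> * u) ((\<tau> - 1) * u)"
  by (auto simp: check_loss_def max_def algebra_simps)

text \<open>Both slopes, \<tau> and \<tau> - 1, have modulus at most 1, and taking maxima is
  nonexpansive.\<close>

lemma check_loss_lipschitz:
  assumes "0 \<le> \<tau>" "\<tau> \<le> 1"
  shows "\<bar>check_loss \<tau> a - check_loss \<tau> b\<bar> \<le> \<bar>a - b\<bar>"
proof -
  have 1: "\<bar>\<tau> * a - \<tau> * b\<bar> \<le> \<bar>a - b\<bar>"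
    using assms by (simp add: abs_mult mult_left_le_one_le flip: right_diff_distrib)
  have "\<bar>(1 - \<tau>) * (a - b)\<bar> \<le> \<bar>a - b\<bar>"
    using assms by (simp add: abs_mult mult_left_le_one_le)
  moreover have "(\<tau> - 1) * a - (\<tau> - 1) * b = - ((1 - \<tau>) * (a - b))"
    by (simp add: algebra_simps)
  ultimately have 2: "\<bar>(\<tau> - 1) * a - (\<tau> - 1) * b\<bar> \<le> \<bar>a - b\<bar>"
    by simp
  have "\<bar>max p r - max p' r'\<bar> \<le> d" if "\<bar>p - p'\<bar> \<le> d" "\<bar>r - r'\<bar> \<le> d" for p p' r r' d :: real
    using that by linarith
  from this[OF 1 2] show ?thesis unfolding check_loss_eq_max .
qed

text \<open>\<open>indicator {..u} y - \<tau>\<close> is a subgradient at \<open>u\<close> of the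
  convex map \<open>\<lambda>v. check_loss \<tau> (y - v)\<close>; at the kink \<open>y = u\<close>
  it is the right derivative. Integrating it produces the distribution function minus
  \<tau>.\<close>

lemma check_loss_subgradient:
  "(v - u) * (indicator {..u} y - \<tau>) \<le> check_loss \<tau> (y - v) - check_loss \<tau> (y - u)"
proof (cases "y \<le> u")
  case True
  then have "check_loss \<tau> (y - u) = (\<tau> - 1) * (y - u)"
    by (auto simp: check_loss_def mult.commute)
  moreover have "(\<tau> - 1) * (y - v) \<le> check_loss \<tau> (y - v)"
    by (simp add: check_loss_eq_max)
  ultimately show ?thesis using True by (simp add: algebra_simps)
next
  case False
  then have "check_loss \<tau> (y - u) = \<tau> * (y - u)"
    by (simp add: check_loss_def)
  moreover have "\<tau> * (y - v) \<le> check_loss \<tau> (y - v)"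
    by (simp add: check_loss_eq_max)
  ultimately show ?thesis using False by (simp add: algebra_simps)
qed

text \<open>The loss dominates the absolute value times the smaller slope modulus; the triangle
  inequality for \<open>u = y - (y - u)\<close> does the rest.\<close>

lemma check_loss_coercive:
  assumes "0 < \<tau>" "\<tau> < 1"
  shows "min \<tau> (1 - \<tau>) * \<bar>u\<bar> - check_loss \<tau> y \<le> check_loss \<tau> (y - u)"
proof -
  have m: "min \<tau> (1 - \<tau>) * \<bar>w\<bar> \<le> check_loss \<tau> w" for w
  proof (cases "w < 0")
    case True
    then show ?thesis
      using mult_right_mono[of "min \<tau> (1 - \<tau>)" "1 - \<tau>" "- w"]
      by (auto simp: check_loss_def algebra_simps)
  next
    case False
    then show ?thesis
      using mult_right_mono[of "min \<tau> (1 - \<tau>)" \<tau> w]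
      by (auto simp: check_loss_def algebra_simps)
  qed
  have "min \<tau> (1 - \<tau>) * \<bar>u\<bar> \<le> min \<tau> (1 - \<tau>) * (\<bar>y\<bar> + \<bar>y - u\<bar>)"
    using assms by (intro mult_left_mono) auto
  then show ?thesis using m[of y] m[of "y - u"] by (simp add: distrib_left)
qed

text \<open>Integrability is imposed on the shifted losses, the form in which it is given for the
  estimated distributions; for the true one it follows from integrability of
  \<open>f x\<close>.\<close>

locale check_risk_space = prob_space \<mu> for \<mu> :: "'a measure" +
  fixes \<tau> :: real and g :: "'a \<Rightarrow> real"
  assumes tau: "0 < \<tau>" "\<tau> < 1"
    and integrable_loss: "\<And>u. integrable \<mu> (\<lambda>e. check_loss \<tau> (g e - u))"
begin

abbreviation "risk \<equiv> check_risk \<tau> \<mu> g"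

lemma risk_lipschitz: "\<bar>risk u - risk v\<bar> \<le> \<bar>u - v\<bar>"
proof -
  have "risk u - risk v = (\<integral>e. check_loss \<tau> (g e - u) - check_loss \<tau> (g e - v) \<partial>\<mu>)"
    unfolding check_risk_def using integrable_loss by simp
  also have "\<bar>\<dots>\<bar> \<le> (\<integral>e. \<bar>check_loss \<tau> (g e - u) - check_loss \<tau> (g e - v)\<bar> \<partial>\<mu>)"
    by (rule integral_abs_bound)
  also have "\<dots> \<le> (\<integral>e. \<bar>u - v\<bar> \<partial>\<mu>)"
  proof (rule integral_mono)
    fix e
    show "\<bar>check_loss \<tau> (g e - u) - check_loss \<tau> (g e - v)\<bar> \<le> \<bar>u - v\<bar>"
      using check_loss_lipschitz[of \<tau> "g e - u" "g e - v"] tau by simp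
  qed (use integrable_loss in auto)
  finally show ?thesis by (simp add: prob_space)
qed

lemma continuous_on_risk: "continuous_on S risk"
  unfolding continuous_on_iff dist_real_def by (metis le_less_trans risk_lipschitz)

lemma convex_on_risk: "convex_on UNIV risk"
proof (rule convex_onI)
  fix t x y :: real assume t: "0 < t" "t < 1"
  have pw: "check_loss \<tau> (w - ((1 - t) * x + t * y))
      \<le> (1 - t) * check_loss \<tau> (w - x) + t * check_loss \<tau> (w - y)" for w
  proof -
    \<comment> \<open>Each linear branch is affine along the segment, hence at most the same convex
      combination of the two maxima.\<close>
    have *: "k * (w - ((1 - t) * x + t * y)) = (1 - t) * (k * (w - x)) + t * (k * (w - y))" for k
      by (simp add: algebra_simps)
    show ?thesis unfolding check_loss_eq_max *
      using t by (intro max.boundedI add_mono mult_left_mono) auto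
  qed
  have "risk ((1 - t) * x + t * y)
      \<le> (\<integral>e. (1 - t) * check_loss \<tau> (g e - x) + t * check_loss \<tau> (g e - y) \<partial>\<mu>)"
    unfolding check_risk_def by (intro integral_mono pw) (use integrable_loss in auto)
  also have "\<dots> = (1 - t) * risk x + t * risk y"
    unfolding check_risk_def using integrable_loss by simp
  finally show "risk ((1 - t) *\<^sub>R x + t *\<^sub>R y) \<le> (1 - t) * risk x + t * risk y"
    by simp
qed simp

lemma risk_coercive: "min \<tau> (1 - \<tau>) * \<bar>u\<bar> - risk 0 \<le> risk u"
proof -
  have "min \<tau> (1 - \<tau>) * \<bar>u\<bar> - risk 0
      = (\<integral>e. min \<tau> (1 - \<tau>) * \<bar>u\<bar> - check_loss \<tau> (g e - 0) \<partial>\<mu>)"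
    unfolding check_risk_def
    by (subst Bochner_Integration.integral_diff)
      (use integrable_loss[of 0] in \<open>auto simp: prob_space\<close>)
  also have "\<dots> \<le> risk u"
    unfolding check_risk_def
  proof (rule integral_mono)
    show "min \<tau> (1 - \<tau>) * \<bar>u\<bar> - check_loss \<tau> (g e - 0) \<le> check_loss \<tau> (g e - u)" for e
      using check_loss_coercive[OF tau, of u "g e"] by simp
  qed (use integrable_loss[of 0] integrable_loss[of u] in auto)
  finally show ?thesis .
qed

text \<open>\<open>LEAST\<close> on the reals is meaningful only if a smallest minimizer exists.
  Coercivity confines the minimizers to a bounded interval, continuity makes them a compact set, and
  a nonempty compact set of reals has a least element.\<close>

lemma est_quantile_minimizer: "is_minimizer risk UNIV (est_quantile \<tau> \<mu> g)"
proof -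
  define k where "k = min \<tau> (1 - \<tau>)"
  have k: "k > 0" using tau by (simp add: k_def)
  \<comment> \<open>Beyond this radius the lower bound of \<open>risk_coercive\<close> exceeds
    \<open>risk 0\<close>.\<close>
  define R where "R = 2 * risk 0 / k"
  have far: "risk 0 < risk u" if "\<bar>u\<bar> > R" for u
  proof -
    have "2 * risk 0 < k * \<bar>u\<bar>"
      using that k by (simp add: R_def pos_divide_less_eq mult.commute)
    then show ?thesis using risk_coercive[of u] by (simp add: k_def)
  qed
  \<comment> \<open>This puts 0 into the interval, so the minimum over the interval is at most
    \<open>risk 0\<close> and is therefore global.\<close>
  have "R \<ge> 0"
    using risk_coercive[of 0] k by (simp add: R_def)
  then obtain u where u: "u \<in> {-R..R}" "\<And>v. v \<in> {-R..R} \<Longrightarrow> risk u \<le> risk v"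
    using continuous_attains_inf[of "{-R..R}" risk] continuous_on_risk by auto
  have u_min: "risk u \<le> risk v" for v
    using u(2)[of v] u(2)[of 0] far[of v] \<open>R \<ge> 0\<close>
    by (cases "\<bar>v\<bar> \<le> R") (auto simp: abs_le_iff)
  \<comment> \<open>The sublevel set at the minimal value, that is, the set of all
    minimizers.\<close>
  define A where "A = {-R..R} \<inter> {v. risk v \<le> risk u}"
  have "compact A"
    unfolding A_def
    by (intro compact_Int_closed compact_Icc closed_Collect_le continuous_on_risk continuous_on_const)
  moreover have "u \<in> A" using u(1) by (simp add: A_def)
  ultimately obtain l where l: "l \<in> A" "\<And>v. v \<in> A \<Longrightarrow> l \<le> v"
    using compact_attains_inf[of A] by blast
  have "is_minimizer risk UNIV l"
    using l(1) u_min by (intro is_minimizerI) (auto simp: A_def intro: order_trans)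
  moreover have "l \<le> v" if "is_minimizer risk UNIV v" for v
  proof (rule l(2))
    have "risk v \<le> risk u" "risk v \<le> risk 0"
      using is_minimizerD(2)[OF that] by auto
    then show "v \<in> A" using far[of v] by (cases "\<bar>v\<bar> > R") (auto simp: A_def)
  qed
  ultimately show ?thesis
    unfolding est_quantile_def by (rule LeastI2_order)
qed

text \<open>The integrated subgradient inequality: the sign of the distribution function minus
  \<tau> decides on which side of \<open>u\<close> the risk cannot drop.\<close>

lemma risk_increment:
  assumes [measurable]: "g \<in> borel_measurable \<mu>"
  shows "(v - u) * (measure \<mu> {e \<in> space \<mu>. g e \<le> u} - \<tau>) \<le> risk v - risk u"
proof -
  have i: "integrable \<mu> (\<lambda>e. indicator {..u} (g e) :: real)"
    by (rule integrable_const_bound[of _ 1]) (auto simp: indicator_def)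
  have "(\<integral>e. indicator {..u} (g e) \<partial>\<mu>) = (\<integral>e. indicator {e \<in> space \<mu>. g e \<le> u} e \<partial>\<mu>)"
    by (rule Bochner_Integration.integral_cong) (auto simp: indicator_def)
  also have "\<dots> = measure \<mu> {e \<in> space \<mu>. g e \<le> u}"
    by (subst Bochner_Integration.integral_indicator) (auto intro: arg_cong[where f = "measure \<mu>"])
  finally have "(v - u) * (measure \<mu> {e \<in> space \<mu>. g e \<le> u} - \<tau>)
      = (\<integral>e. (v - u) * (indicator {..u} (g e) - \<tau>) \<partial>\<mu>)"
    using i by (simp add: prob_space)
  also have "\<dots> \<le> (\<integral>e. check_loss \<tau> (g e - v) - check_loss \<tau> (g e - u) \<partial>\<mu>)"
    by (intro integral_mono check_loss_subgradient) (use i integrable_loss in auto)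
  also have "\<dots> = risk v - risk u"
    unfolding check_risk_def using integrable_loss by simp
  finally show ?thesis .
qed

text \<open>This links the quantile as an infimum of levels to risk minimization. Right of it the
  distribution function is at least \<tau>, left of it below \<tau>, so the risk does not decrease
  when moving away on either side.\<close>

lemma quantile_minimizer:
  assumes g: "g \<in> borel_measurable \<mu>"
  shows "is_minimizer risk UNIV (quantile \<tau> \<mu> g)"
proof (rule is_minimizerI)
  define F where "F t = measure \<mu> {e \<in> space \<mu>. g e \<le> t}" for t
  define S where "S = {t. \<tau> \<le> F t}"
  define u where "u = quantile \<tau> \<mu> g"
  have u: "u = Inf S" by (simp add: u_def quantile_def S_def F_def)
  have F: "F = cdf (distr \<mu> borel g)"
    using g by (auto simp: fun_eq_iff F_def cdf_def measure_distr vimage_def Int_def conj_commute)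
  interpret D: real_distribution "distr \<mu> borel g"
    using g by (rule real_distribution_distr)
  have F_mono: "F s \<le> F t" if "s \<le> t" for s t
    unfolding F using that by (rule D.cdf_nondecreasing)
  \<comment> \<open>The limits 1 and 0 of the distribution function make \<open>S\<close> nonempty
    and bounded below, so that \<open>Inf S\<close> is a genuine infimum.\<close>
  obtain t1 where "\<tau> < F t1"
    using order_tendstoD(1)[OF D.cdf_lim_at_top_prob tau(2)]
    by (auto simp: F eventually_at_top_linorder)
  then have ne: "S \<noteq> {}" by (auto simp: S_def intro: less_imp_le)
  obtain t0 where t0: "F t0 < \<tau>"
    using order_tendstoD(2)[OF D.cdf_lim_at_bot tau(1)]
    by (auto simp: F eventually_at_bot_linorder)
  have bdd: "bdd_below S"
  proof (rule bdd_belowI)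
    show "t0 \<le> t" if "t \<in> S" for t
      using F_mono[of t t0] that t0 by (force simp: S_def)
  qed
  have right: "risk t \<le> risk v" if "u < t" "t \<le> v" for t v
  proof -
    obtain s where "s \<in> S" "s < t" using cInf_lessD[OF ne] \<open>u < t\<close> by (auto simp: u)
    then have "\<tau> \<le> F t" using F_mono[of s t] by (auto simp: S_def)
    then have "0 \<le> (v - t) * (F t - \<tau>)" using that by simp
    then show ?thesis using risk_increment[OF g, of v t] by (simp add: F_def)
  qed
  have left: "risk t \<le> risk v" if "t < u" "v \<le> t" for t v
  proof -
    have "t \<notin> S" using that cInf_lower[OF _ bdd, of t] by (auto simp: u)
    then have "0 \<le> (v - t) * (F t - \<tau>)"
      using that by (intro mult_nonpos_nonpos) (auto simp: S_def)
    then show ?thesis using risk_increment[OF g, of v t] by (simp add: F_def)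
  qed
  \<comment> \<open>The monotonicity facts concern points strictly beside \<open>u\<close>;
    continuity carries them to \<open>u\<close>, approached from the side of
    \<open>v\<close>.\<close>
  have lim: "(risk \<longlongrightarrow> risk u) (at u within A)" for A
  proof -
    have "(risk \<longlongrightarrow> risk u) (at u)"
      using continuous_on_risk[of UNIV] by (simp add: continuous_on_def)
    then show ?thesis by (rule tendsto_within_subset) simp
  qed
  show "risk (quantile \<tau> \<mu> g) \<le> risk v" for v
    unfolding u_def[symmetric]
  proof (cases u v rule: linorder_cases)
    case less
    show "risk u \<le> risk v"
    proof (rule tendsto_upperbound[OF lim])
      show "\<forall>\<^sub>F t in at_right u. risk t \<le> risk v"
        using less right by (auto simp: eventually_at_right intro!: exI[of _ v])
    qed simp
  next
    case greater
    show "risk u \<le> risk v"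
    proof (rule tendsto_upperbound[OF lim])
      show "\<forall>\<^sub>F t in at_left u. risk t \<le> risk v"
        using greater left by (auto simp: eventually_at_left intro!: exI[of _ v])
    qed simp
  qed simp
qed simp

end

section \<open>Uniform convergence and convergence of optimal solutions\<close>

lemma holder_bound_small:
  fixes L \<beta> :: real
  assumes "\<beta> > 0" "e > 0"
  obtains d where "d > 0" "\<And>r. 0 \<le> r \<Longrightarrow> r < d \<Longrightarrow> L * r powr \<beta> < e"
proof -
  have "((\<lambda>r::real. L * r powr \<beta>) \<longlongrightarrow> L * 0 powr \<beta>) (at_right 0)"
    using assms by (intro tendsto_intros tendsto_powr') (auto simp: eventually_at_filter)
  then have "\<forall>\<^sub>F r in at_right 0. L * r powr \<beta> < e"
    using assms by (auto dest: order_tendstoD(2))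
  then obtain d where d: "d > 0" "\<And>r. 0 < r \<Longrightarrow> r < d \<Longrightarrow> L * r powr \<beta> < e"
    unfolding eventually_at_right_field by auto
  \<comment> \<open>The right-hand limit leaves out \<open>r = 0\<close>, the case of coinciding
    points, where \<open>0 powr \<beta> = 0\<close>.\<close>
  have "L * r powr \<beta> < e" if "0 \<le> r" "r < d" for r
    using that d(2)[of r] assms(2) by (cases "r = 0") auto
  with d(1) show ?thesis by (rule that)
qed

lemma holder_continuous_on:
  fixes g :: "'a::real_normed_vector \<Rightarrow> real"
  assumes "\<beta> > 0" "\<And>x y. x \<in> S \<Longrightarrow> y \<in> S \<Longrightarrow> \<bar>g x - g y\<bar> \<le> L * norm (x - y) powr \<beta>"
  shows "continuous_on S g"
  unfolding continuous_on_iff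
proof (intro ballI allI impI)
  fix x and e :: real assume "x \<in> S" "0 < e"
  obtain d where d: "d > 0" "\<And>r. 0 \<le> r \<Longrightarrow> r < d \<Longrightarrow> L * r powr \<beta> < e"
    using holder_bound_small[OF assms(1) \<open>0 < e\<close>, of L] by blast
  have "dist (g y) (g x) < e" if "y \<in> S" "dist y x < d" for y
    using assms(2)[OF \<open>y \<in> S\<close> \<open>x \<in> S\<close>] d(2)[of "norm (y - x)"] that(2)
    by (simp add: dist_norm)
  with d(1) show "\<exists>d>0. \<forall>y\<in>S. dist y x < d \<longrightarrow> dist (g y) (g x) < e" by blast
qed

text \<open>An \<open>e / 3\<close> argument: the common modulus moves from \<open>x\<close> to a
  point of a finite net in \<open>D\<close>, convergence acts there, and uniform continuity of
  \<open>g\<close> moves back.\<close>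

lemma equi_holder_uniform_limit:
  fixes G :: "'i \<Rightarrow> 'a::real_normed_vector \<Rightarrow> real"
  assumes S: "compact S" and D: "D \<subseteq> S" "S \<subseteq> closure D"
    and beta: "\<beta> > 0"
    and holder: "\<forall>\<^sub>F N in F. \<forall>x\<in>S. \<forall>y\<in>S. \<bar>G N x - G N y\<bar> \<le> L * norm (x - y) powr \<beta>"
    and cont: "continuous_on S g"
    and conv: "\<And>x. x \<in> D \<Longrightarrow> ((\<lambda>N. G N x) \<longlongrightarrow> g x) F"
  shows "uniform_limit S G g F"
proof (rule uniform_limitI)
  fix e :: real assume e: "0 < e"
  obtain d1 where d1: "d1 > 0" "\<And>r. 0 \<le> r \<Longrightarrow> r < d1 \<Longrightarrow> L * r powr \<beta> < e / 3"
    using holder_bound_small[OF beta, of "e / 3" L] e by auto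
  obtain d2 where d2: "d2 > 0" "\<And>x y. x \<in> S \<Longrightarrow> y \<in> S \<Longrightarrow> dist x y < d2 \<Longrightarrow> dist (g x) (g y) < e / 3"
    using uniformly_continuous_onE[OF compact_uniformly_continuous[OF cont S], of "e / 3"] e
    by (auto simp: dist_commute)
  define d where "d = min d1 d2"
  have "d > 0" using d1 d2 by (simp add: d_def)
  \<comment> \<open>Density allows the centres of the covering balls to be taken in
    \<open>D\<close>, where convergence is known.\<close>
  have "S \<subseteq> (\<Union>x\<in>D. ball x d)"
  proof
    fix x assume "x \<in> S"
    then obtain y where "y \<in> D" "dist y x < d"
      using D(2) \<open>d > 0\<close> by (auto simp: subset_iff closure_approachable)
    then show "x \<in> (\<Union>x\<in>D. ball x d)" by auto
  qed
  then obtain D' where D': "D' \<subseteq> D" "finite D'" "S \<subseteq> (\<Union>x\<in>D'. ball x d)"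
    using compactE_image[OF S, of D "\<lambda>x. ball x d"] by auto
  have "\<forall>\<^sub>F N in F. \<forall>x\<in>D'. dist (G N x) (g x) < e / 3"
    using D' conv e by (intro eventually_ball_finite ballI tendstoD) auto
  then show "\<forall>\<^sub>F N in F. \<forall>x\<in>S. dist (G N x) (g x) < e"
    using holder
  proof eventually_elim
    case (elim N)
    show ?case
    proof
      fix x assume x: "x \<in> S"
      then obtain y where y: "y \<in> D'" "dist y x < d" using D'(3) by auto
      then have yS: "y \<in> S" using D' D by auto
      have "\<bar>G N x - G N y\<bar> < e / 3"
        using elim(2)[rule_format, OF x yS] d1(2)[of "norm (x - y)"] y
        by (simp add: d_def dist_norm norm_minus_commute)
      moreover have "\<bar>g y - g x\<bar> < e / 3"
        using d2(2)[OF yS x] y by (simp add: d_def dist_real_def)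
      moreover have "\<bar>G N y - g y\<bar> < e / 3"
        using elim(1) y by (simp add: dist_real_def)
      ultimately show "dist (G N x) (g x) < e" unfolding dist_real_def by linarith
    qed
  qed
qed

text \<open>Under a uniform error below \<open>e\<close>, a minimizer of \<open>G N\<close> is
  \<open>2 * e\<close>-optimal for \<open>g\<close>. This controls both values; for the solutions,
  compactness gives a positive gap of \<open>g\<close> away from its minimizers.\<close>

lemma uniform_limit_opt:
  fixes G :: "'i \<Rightarrow> 'a::real_normed_vector \<Rightarrow> real"
  assumes S: "compact S" "S \<noteq> {}"
    and cont: "continuous_on S g" "\<forall>\<^sub>F N in F. continuous_on S (G N)"
    and unif: "uniform_limit S G g F"
  shows opt_value_tendsto: "((\<lambda>N. opt_value (G N) S) \<longlongrightarrow> opt_value g S) F"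
    and SUP_opt_set_tendsto: "((\<lambda>N. SUP x\<in>opt_set (G N) S. g x) \<longlongrightarrow> opt_value g S) F"
    and set_deviation_opt_set_tendsto: "((\<lambda>N. set_deviation (opt_set (G N) S) (opt_set g S)) \<longlongrightarrow> 0) F"
proof -
  obtain x0 where x0: "is_minimizer g S x0"
    using continuous_minimizer_exists[OF S cont(1)] .
  define v where "v = opt_value g S"
  have v: "v = g x0" "x0 \<in> S" "\<And>x. x \<in> S \<Longrightarrow> v \<le> g x"
    using x0 by (auto simp: v_def opt_value_eq dest: is_minimizerD)
  \<comment> \<open>The minimizer is carried along because it makes \<open>opt_set (G N) S\<close>
    nonempty, as the real suprema below require.\<close>
  have close: "\<forall>\<^sub>F N in F. \<exists>xN. is_minimizer (G N) S xN \<and> (\<forall>x\<in>S. \<bar>G N x - g x\<bar> < e)"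
    if "e > 0" for e
    using uniform_limitD[OF unif that] cont(2)
    by eventually_elim (metis S continuous_minimizer_exists dist_real_def)
  \<comment> \<open>Pass from \<open>g x\<close> to \<open>G N x\<close>, compare with
    \<open>G N x0\<close> by minimality, and return to \<open>g x0 = v\<close>; each passage costs
    less than \<open>e\<close>.\<close>
  have near: "g x < v + 2 * e" if "is_minimizer (G N) S x" "\<forall>x\<in>S. \<bar>G N x - g x\<bar> < e" for N x e
    using is_minimizerD[OF that(1)] that(2) v by (smt (verit))
  show "((\<lambda>N. opt_value (G N) S) \<longlongrightarrow> opt_value g S) F"
  proof (rule tendstoI)
    fix e :: real assume "e > 0"
    from close[OF this] show "\<forall>\<^sub>F N in F. dist (opt_value (G N) S) (opt_value g S) < e"
    proof eventually_elim
      case (elim N)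
      then obtain xN where xN: "is_minimizer (G N) S xN" "\<forall>x\<in>S. \<bar>G N x - g x\<bar> < e" by blast
      show ?case
        using is_minimizerD[OF xN(1)] xN(2) v v(3)[of xN]
        unfolding opt_value_eq[OF xN(1)] v_def[symmetric] dist_real_def by (smt (verit))
    qed
  qed
  show "((\<lambda>N. SUP x\<in>opt_set (G N) S. g x) \<longlongrightarrow> opt_value g S) F"
  proof (rule tendstoI)
    fix e :: real assume "e > 0"
    then have "e / 3 > 0" by simp
    from close[OF this] show "\<forall>\<^sub>F N in F. dist (SUP x\<in>opt_set (G N) S. g x) (opt_value g S) < e"
    proof eventually_elim
      case (elim N)
      then obtain xN where xN: "is_minimizer (G N) S xN" "\<forall>x\<in>S. \<bar>G N x - g x\<bar> < e / 3" by blast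
      \<comment> \<open>Serves twice: as the upper estimate, and as the boundedness that makes the
        supremum an upper bound. With \<open>e / 3\<close> it stays strictly below
        \<open>v + e\<close>.\<close>
      have ub: "g x \<le> v + 2 * (e / 3)" if "x \<in> opt_set (G N) S" for x
        using near[OF _ xN(2), of x] that by (auto simp: opt_set_def)
      have xN_opt: "xN \<in> opt_set (G N) S" using xN by (simp add: opt_set_def)
      then have "(SUP x\<in>opt_set (G N) S. g x) \<le> v + 2 * (e / 3)"
        using ub by (intro cSUP_least) auto
      moreover have "v \<le> g xN" using v is_minimizerD(1)[OF xN(1)] by auto
      moreover have "g xN \<le> (SUP x\<in>opt_set (G N) S. g x)"
        using xN_opt ub by (intro cSUP_upper bdd_aboveI2[where M = "v + 2 * (e / 3)"]) auto
      ultimately show ?case using \<open>e > 0\<close> by (simp add: dist_real_def v_def[symmetric])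
    qed
  qed
  define X0 where "X0 = opt_set g S"
  have "X0 \<noteq> {}" using x0 by (auto simp: X0_def opt_set_def)
  have X0: "x \<in> X0" if "x \<in> S" "g x \<le> v" for x
    using is_minimizer_opt_value[OF that(1) _ x0] that v(3)[of x] by (force simp: X0_def opt_set_def v_def)
  have dev: "set_deviation A X0 = (SUP x\<in>A. infdist x X0)" for A
    using \<open>X0 \<noteq> {}\<close> by (simp add: set_deviation_def infdist_def dist_norm)
  show "((\<lambda>N. set_deviation (opt_set (G N) S) (opt_set g S)) \<longlongrightarrow> 0) F"
    unfolding X0_def[symmetric] dev
  proof (rule tendstoI)
    fix e :: real assume "e > 0"
    \<comment> \<open>The radius \<open>e / 2\<close> leaves room for the strict inequality after
      passing to the supremum.\<close>
    define K where "K = {x \<in> S. e / 2 \<le> infdist x X0}"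
    have "compact K"
      unfolding K_def Collect_conj_eq using S
      by (auto intro!: compact_Int_closed closed_Collect_le continuous_intros)
    \<comment> \<open>Outside the \<open>e / 2\<close>-neighbourhood of the optimal set, \<open>g\<close> exceeds \<open>v\<close> by a fixed gap.\<close>
    obtain d where d: "d > 0" "\<And>x. x \<in> K \<Longrightarrow> v + 2 * d \<le> g x"
    proof (cases "K = {}")
      case True
      then show ?thesis using that[of 1] by simp
    next
      case False
      have "continuous_on K g" using cont(1) by (rule continuous_on_subset) (auto simp: K_def)
      then obtain k where k: "k \<in> K" "\<And>x. x \<in> K \<Longrightarrow> g k \<le> g x"
        using continuous_attains_inf[OF \<open>compact K\<close> False] by blast
      have "v < g k"
      proof (rule ccontr)
        assume "\<not> v < g k"
        then have "k \<in> X0" using k by (intro X0) (auto simp: K_def)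
        then show False using k \<open>e > 0\<close> by (simp add: K_def)
      qed
      \<comment> \<open>Half the gap, because \<open>near\<close> loses twice the uniform
        error.\<close>
      then show ?thesis using k(2) by (intro that[of "(g k - v) / 2"]) (auto simp: field_simps)
    qed
    from close[OF d(1)] show "\<forall>\<^sub>F N in F. dist (SUP x\<in>opt_set (G N) S. infdist x X0) 0 < e"
    proof eventually_elim
      case (elim N)
      then obtain xN where xN: "is_minimizer (G N) S xN" "\<forall>x\<in>S. \<bar>G N x - g x\<bar> < d" by blast
      have ub: "infdist x X0 \<le> e / 2" if "x \<in> opt_set (G N) S" for x
      proof (rule ccontr)
        assume "\<not> infdist x X0 \<le> e / 2"
        moreover have "is_minimizer (G N) S x" using that by (simp add: opt_set_def)
        ultimately have "x \<in> K" "g x < v + 2 * d"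
          using is_minimizerD(1)[of "G N" S x] near[OF _ xN(2), of x] by (auto simp: K_def)
        then show False using d(2)[of x] by simp
      qed
      have xN_opt: "xN \<in> opt_set (G N) S" using xN by (simp add: opt_set_def)
      then have "(SUP x\<in>opt_set (G N) S. infdist x X0) \<le> e / 2"
        using ub by (intro cSUP_least) auto
      moreover have "infdist xN X0 \<le> (SUP x\<in>opt_set (G N) S. infdist x X0)"
        using xN_opt ub by (intro cSUP_upper bdd_aboveI2[where M = "e / 2"]) auto
      ultimately show ?case
        using \<open>e > 0\<close> infdist_nonneg[of xN X0] by (simp add: dist_real_def)
    qed
  qed
qed

section \<open>Consistency of the estimated quantile problem\<close>

theorem theorem3:
  fixes T :: "real^'n^'r" and W :: "real^'m^'r" and C :: "real^'l^'r"
    and h :: "real^'r" and q :: "real^'m"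
    and X :: "(real^'n) set" and \<tau> :: real
    and M :: "'w measure"
    and Z :: "'w \<Rightarrow> real^'p" and \<xi> :: "'w \<Rightarrow> real^'l"
    and Zs :: "nat \<Rightarrow> 'w \<Rightarrow> real^'p" and \<xi>s :: "nat \<Rightarrow> 'w \<Rightarrow> real^'l"
    and PZ :: "(real^'p) measure" and \<Xi> :: "(real^'l) set" and \<Z> :: "(real^'p) set"
    and P :: "real^'p \<Rightarrow> (real^'l) measure"
    and est :: "((real^'p) \<times> (real^'l)) list \<Rightarrow> real^'p \<Rightarrow> (real^'l) measure"
    and Phat :: "nat \<Rightarrow> 'w \<Rightarrow> real^'p \<Rightarrow> (real^'l) measure"
    and f :: "real^'n \<Rightarrow> real^'l \<Rightarrow> real"
    and Q :: "real^'n \<Rightarrow> real^'p \<Rightarrow> real"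
    and Qhat :: "nat \<Rightarrow> 'w \<Rightarrow> real^'n \<Rightarrow> real^'p \<Rightarrow> real"
  assumes X_nonempty: "X \<noteq> {}"
    and tau: "0 < \<tau>" "\<tau> < 1"
    and prob: "prob_space M"
    and rv: "Z \<in> borel_measurable M" "\<xi> \<in> borel_measurable M"
    and PZ_eq: "PZ = distr M borel Z"
    and supports: "\<Z> = msupport PZ" "\<Xi> = msupport (distr M borel \<xi>)"
    and cond: "is_cond_distr M \<xi> Z P"
    and f_eq: "f = recourse T W C h q"
    and lp_optimal: "\<And>x e. x \<in> X \<Longrightarrow> e \<in> \<Xi> \<Longrightarrow>
          \<exists>y. is_minimizer (\<lambda>y. q \<bullet> y) {y. lp_feasible T W C h x e y} y"
    and f_pos: "\<And>x e. x \<in> X \<Longrightarrow> e \<in> \<Xi> \<Longrightarrow> 0 < f x e"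
    and Q_eq: "Q = (\<lambda>x z. quantile \<tau> (P z) (f x))"
    and samples_rv: "\<And>i. i \<ge> 1 \<Longrightarrow> Zs i \<in> borel_measurable M"
          "\<And>i. i \<ge> 1 \<Longrightarrow> \<xi>s i \<in> borel_measurable M"
    and samples_distr: "\<And>i. i \<ge> 1 \<Longrightarrow>
          distr M borel (\<lambda>\<omega>. (Zs i \<omega>, \<xi>s i \<omega>)) = distr M borel (\<lambda>\<omega>. (Z \<omega>, \<xi> \<omega>))"
    and Phat_eq: "Phat = (\<lambda>N \<omega>. est (map (\<lambda>i. (Zs i \<omega>, \<xi>s i \<omega>)) [1..<Suc N]))"
    and Phat_prob: "\<And>N \<omega> z. N \<ge> 1 \<Longrightarrow> \<omega> \<in> space M \<Longrightarrow> z \<in> \<Z> \<Longrightarrow>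
          prob_space (Phat N \<omega> z) \<and> sets (Phat N \<omega> z) = sets borel \<and>
          (AE e in Phat N \<omega> z. e \<in> \<Xi>)"
    and Phat_integrable: "\<And>N \<omega> z x u. N \<ge> 1 \<Longrightarrow> \<omega> \<in> space M \<Longrightarrow> z \<in> \<Z> \<Longrightarrow> x \<in> X \<Longrightarrow>
          integrable (Phat N \<omega> z) (\<lambda>e. check_loss \<tau> (f x e - u))"
    and Qhat_eq: "Qhat = (\<lambda>N \<omega> x z. est_quantile \<tau> (Phat N \<omega> z) (f x))"
    and A1: "compact X"
    and A2: "AE z in PZ. z \<in> \<Z> \<longrightarrow> (\<forall>x\<in>X.
          integrable (P z) (f x) \<and>
          (\<exists>!u. is_minimizer (check_risk \<tau> (P z) (f x)) UNIV u))"
    and A3: "AE z in PZ. z \<in> \<Z> \<longrightarrow>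
          (\<exists>\<alpha>>0. \<exists>L1>0. \<forall>x1\<in>X. \<forall>x2\<in>X.
             \<bar>Q x1 z - Q x2 z\<bar> \<le> L1 * norm (x1 - x2) powr \<alpha>) \<and>
          (\<exists>\<beta>>0. \<exists>L2>0. \<forall>N\<ge>1. \<forall>\<omega>\<in>space M. \<forall>x1\<in>X. \<forall>x2\<in>X.
             \<bar>Qhat N \<omega> x1 z - Qhat N \<omega> x2 z\<bar> \<le> L2 * norm (x1 - x2) powr \<beta>)"
    and A4: "AE z in PZ. z \<in> \<Z> \<longrightarrow>
          (\<exists>B. compact B \<and> B \<subseteq> \<Xi> \<and> measure (P z) B > 0) \<and>
          (\<forall>x\<in>X. \<forall>u. AE \<omega> in M.
             (\<lambda>N. check_risk \<tau> (Phat N \<omega> z) (f x) u) \<longlonglongrightarrow> check_risk \<tau> (P z) (f x) u) \<and>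
          (\<forall>A\<in>sets borel. A \<subseteq> \<Xi> \<longrightarrow> (AE \<omega> in M.
             (\<lambda>N. \<integral>e. indicator A e \<partial>Phat N \<omega> z) \<longlonglongrightarrow> (\<integral>e. indicator A e \<partial>P z :: real)))"
  shows "AE z in PZ. z \<in> \<Z> \<longrightarrow> (AE \<omega> in M.
          (\<lambda>N. opt_value (\<lambda>x. Qhat N \<omega> x z) X) \<longlonglongrightarrow> opt_value (\<lambda>x. Q x z) X \<and>
          (\<lambda>N. SUP x\<in>opt_set (\<lambda>x. Qhat N \<omega> x z) X. Q x z) \<longlonglongrightarrow> opt_value (\<lambda>x. Q x z) X \<and>
          (\<lambda>N. set_deviation (opt_set (\<lambda>x. Qhat N \<omega> x z) X) (opt_set (\<lambda>x. Q x z) X)) \<longlonglongrightarrow> 0)"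
proof -
  obtain D where D: "countable D" "D \<subseteq> X" "X \<subseteq> closure D"
    using separable[of X] .
  have P: "prob_space (P z)" "sets (P z) = sets borel" for z
    using cond measurable_space[of P borel "prob_algebra borel" z]
    by (auto simp: is_cond_distr_def space_prob_algebra)
  show ?thesis
    using A2 A3 A4
  proof (eventually_elim, intro impI)
    fix z
    assume a2: "z \<in> \<Z> \<longrightarrow> (\<forall>x\<in>X. integrable (P z) (f x) \<and>
          (\<exists>!u. is_minimizer (check_risk \<tau> (P z) (f x)) UNIV u))"
      and a3: "z \<in> \<Z> \<longrightarrow>
          (\<exists>\<alpha>>0. \<exists>L1>0. \<forall>x1\<in>X. \<forall>x2\<in>X.
             \<bar>Q x1 z - Q x2 z\<bar> \<le> L1 * norm (x1 - x2) powr \<alpha>) \<and>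
          (\<exists>\<beta>>0. \<exists>L2>0. \<forall>N\<ge>1. \<forall>\<omega>\<in>space M. \<forall>x1\<in>X. \<forall>x2\<in>X.
             \<bar>Qhat N \<omega> x1 z - Qhat N \<omega> x2 z\<bar> \<le> L2 * norm (x1 - x2) powr \<beta>)"
      and a4: "z \<in> \<Z> \<longrightarrow>
          (\<exists>B. compact B \<and> B \<subseteq> \<Xi> \<and> measure (P z) B > 0) \<and>
          (\<forall>x\<in>X. \<forall>u. AE \<omega> in M.
             (\<lambda>N. check_risk \<tau> (Phat N \<omega> z) (f x) u) \<longlonglongrightarrow> check_risk \<tau> (P z) (f x) u) \<and>
          (\<forall>A\<in>sets borel. A \<subseteq> \<Xi> \<longrightarrow> (AE \<omega> in M.
             (\<lambda>N. \<integral>e. indicator A e \<partial>Phat N \<omega> z) \<longlonglongrightarrow> (\<integral>e. indicator A e \<partial>P z :: real)))"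
      and z: "z \<in> \<Z>"
    have int: "integrable (P z) (f x)"
      and uniq: "\<exists>!u. is_minimizer (check_risk \<tau> (P z) (f x)) UNIV u" if "x \<in> X" for x
      using bspec[OF mp[OF a2 z] that] by (rule conjunct1, rule conjunct2)
    have conv: "AE \<omega> in M. (\<lambda>N. check_risk \<tau> (Phat N \<omega> z) (f x) u) \<longlonglongrightarrow> check_risk \<tau> (P z) (f x) u"
      if "x \<in> X" for x u
      using mp[OF a4 z, THEN conjunct2, THEN conjunct1] that by blast
    obtain \<alpha> L1 where alpha: "\<alpha> > 0"
      "\<And>x1 x2. x1 \<in> X \<Longrightarrow> x2 \<in> X \<Longrightarrow> \<bar>Q x1 z - Q x2 z\<bar> \<le> L1 * norm (x1 - x2) powr \<alpha>"
      using mp[OF a3 z, THEN conjunct1] by metis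
    obtain \<beta> L2 where beta: "\<beta> > 0"
      "\<And>N \<omega> x1 x2. N \<ge> 1 \<Longrightarrow> \<omega> \<in> space M \<Longrightarrow> x1 \<in> X \<Longrightarrow> x2 \<in> X \<Longrightarrow>
         \<bar>Qhat N \<omega> x1 z - Qhat N \<omega> x2 z\<bar> \<le> L2 * norm (x1 - x2) powr \<beta>"
      using mp[OF a3 z, THEN conjunct2] by metis
    have Q_cont: "continuous_on X (\<lambda>x. Q x z)"
      using alpha by (rule holder_continuous_on)
    have true_risk: "check_risk_space (P z) \<tau> (f x)" if "x \<in> X" for x
    proof -
      interpret prob_space "P z" by (rule P)
      have "integrable (P z) (\<lambda>e. check_loss \<tau> (f x e - u))" for u
        unfolding check_loss_eq_max using int[OF that] by (intro integrable_max) auto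
      then show ?thesis using tau by unfold_locales
    qed
    have est_risk: "check_risk_space (Phat N \<omega> z) \<tau> (f x)"
      if "N \<ge> 1" "\<omega> \<in> space M" "x \<in> X" for N \<omega> x
    proof -
      interpret prob_space "Phat N \<omega> z" using Phat_prob[OF that(1,2) z] by simp
      show ?thesis using tau Phat_integrable[OF that(1,2) z that(3)] by unfold_locales
    qed
    \<comment> \<open>Uniqueness of the minimizer upgrades minimality of the quantile to the strict
      inequality that \<open>convex_minimizers_tendsto\<close> asks for.\<close>
    have Q_less: "check_risk \<tau> (P z) (f x) (Q x z) < check_risk \<tau> (P z) (f x) u"
      if x: "x \<in> X" and u: "u \<noteq> Q x z" for x u
    proof -
      have *: "is_minimizer (check_risk \<tau> (P z) (f x)) UNIV (Q x z)"
        unfolding Q_eq using check_risk_space.quantile_minimizer[OF true_risk[OF x]] int[OF x] by auto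
      then have "\<not> is_minimizer (check_risk \<tau> (P z) (f x)) UNIV u"
        using uniq[OF x] u by blast
      then show ?thesis
        using is_minimizerD(2)[OF *] by (meson UNIV_I is_minimizerI not_le order_trans)
    qed
    \<comment> \<open>The null set in \<open>conv\<close> depends on \<open>x\<close> and
      \<open>u\<close>; with \<open>D\<close> and the rationals countable, a single null set serves
      all pairs.\<close>
    have "AE \<omega> in M. \<forall>x\<in>D. \<forall>u\<in>\<rat>.
        (\<lambda>N. check_risk \<tau> (Phat N \<omega> z) (f x) u) \<longlonglongrightarrow> check_risk \<tau> (P z) (f x) u"
      using D conv by (intro AE_ball_countable[THEN iffD2] ballI) (auto simp: countable_rat)
    then show "AE \<omega> in M.
          (\<lambda>N. opt_value (\<lambda>x. Qhat N \<omega> x z) X) \<longlonglongrightarrow> opt_value (\<lambda>x. Q x z) X \<and>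
          (\<lambda>N. SUP x\<in>opt_set (\<lambda>x. Qhat N \<omega> x z) X. Q x z) \<longlonglongrightarrow> opt_value (\<lambda>x. Q x z) X \<and>
          (\<lambda>N. set_deviation (opt_set (\<lambda>x. Qhat N \<omega> x z) X) (opt_set (\<lambda>x. Q x z) X)) \<longlonglongrightarrow> 0"
      using AE_space
    proof eventually_elim
      case (elim \<omega>)
      have "(\<lambda>N. Qhat N \<omega> x z) \<longlonglongrightarrow> Q x z" if x: "x \<in> D" for x
      proof (rule convex_minimizers_tendsto)
        have xX: "x \<in> X" using x D by auto
        show "\<forall>\<^sub>F N in sequentially. convex_on UNIV (check_risk \<tau> (Phat N \<omega> z) (f x)) \<and>
            is_minimizer (check_risk \<tau> (Phat N \<omega> z) (f x)) UNIV (Qhat N \<omega> x z)"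
          \<comment> \<open>The assumptions on the estimates start at \<open>N = 1\<close>, so
            \<open>N = 0\<close> is discarded.\<close>
          unfolding Qhat_eq using eventually_ge_at_top[of 1]
          by eventually_elim
            (use est_risk elim(2) xX check_risk_space.convex_on_risk
              check_risk_space.est_quantile_minimizer in blast)
        show "isCont (check_risk \<tau> (P z) (f x)) (Q x z)"
          using check_risk_space.continuous_on_risk[OF true_risk[OF xX], of UNIV]
          by (simp add: continuous_on_eq_continuous_at)
        show "check_risk \<tau> (P z) (f x) (Q x z) < check_risk \<tau> (P z) (f x) u"
          if "u \<noteq> Q x z" for u
          using Q_less[OF xX that] .
      qed (use elim(1) x in auto)
      \<comment> \<open>\<open>L2\<close> and \<beta> were fixed before \<omega> and
        \<open>N\<close>, which gives one modulus along the whole sequence.\<close>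
      moreover have ev: "\<forall>\<^sub>F N in sequentially. \<forall>x1\<in>X. \<forall>x2\<in>X.
          \<bar>Qhat N \<omega> x1 z - Qhat N \<omega> x2 z\<bar> \<le> L2 * norm (x1 - x2) powr \<beta>"
        using eventually_ge_at_top[of 1] by eventually_elim (use beta(2) elim(2) in blast)
      ultimately have unif: "uniform_limit X (\<lambda>N x. Qhat N \<omega> x z) (\<lambda>x. Q x z) sequentially"
        using A1 D(2,3) beta(1) Q_cont by (intro equi_holder_uniform_limit) auto
      have "\<forall>\<^sub>F N in sequentially. continuous_on X (\<lambda>x. Qhat N \<omega> x z)"
        using ev by eventually_elim (rule holder_continuous_on[OF beta(1)], blast)
      from uniform_limit_opt[OF A1 X_nonempty Q_cont this unif] show ?case by blast
    qed
  qed
qed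

end
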